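(* Let $k$ be a field and $n\ge1$. A point $x\in\mathbb{P}^N(k)$, $N=2^{n-2}\left(4+\binom{n}{2}\right)-1$, satisfies all restricted Grassmann--Plücker relations if and only if it satisfies those restricted Grassmann--Plücker relations with $|S\setminus T|\le 4$ and the set $\{B\in\mathcal{T}_n\cup\mathcal{A}_n: x_B\ne0\}$ is the set of bases of an antisymmetric matroid on $E$.
   Context: Let $E=[n]\cup[n]^*$ with order $1<\dots<n<1^*<\dots<n^*$ and involution $i\leftrightarrow i^*$; a skew pair is $\{i,i^*\}$; transversals $\mathcal{T}_n$ are $n$-subsets with no skew pair, almost-transversals $\mathcal{A}_n$ are $n$-subsets with exactly one skew pair; a subtransversal is a subset of a transversal; $\sigma_S(x)$ is the number of elements of $S$ smaller than $x$. The projective space $\mathbb{P}^N(k)$ has coordinates $x_B$, $B\in\mathcal{T}_n\cup\mathcal{A}_n$, subject to $(-1)^ix_{S\cup\{i,i^*\}}=(-1)^jx_{S\cup\{j,j^*\}}$ for every subtransversal $S$ of size $n-2$ and distinct $i,j\in[n]$ with $\{i,i^*\},\{j,j^*\}$ disjoint from $S$. The restricted Grassmann--Plücker relations are $\sum_{e\in S\setminus T}(-1)^{\sigma_S(e)+\sigma_T(e)}x_{S\setminus\{e\}}x_{T\cup\{e\}}=0$ for $S\subseteq E$ of size $n+1$ containing exactly one skew pair and $T\subseteq E$ of size $n-1$ containing no skew pair. An antisymmetric matroid on $E$ is a pair $(E,\mathcal{B})$ with $\mathcal{B}\subseteq\mathcal{T}_n\cup\mathcal{A}_n$ such that (B1)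 $\mathcal{B}\ne\emptyset$; (B2) for $T\in\mathcal{T}_n$ and distinct skew pairs $p,q$, $(T\cup p)\setminus q\in\mathcal{B}$ iff $(T\cup q)\setminus p\in\mathcal{B}$; (Exch) for $B,B'\in\mathcal{B}$ and $e\in B\setminus B'$, if $B\setminus\{e\}$ has no skew pair and $B'\cup\{e\}$ has exactly one skew pair, then there is $f\in B'\setminus B$ with $(B\setminus\{e\})\cup\{f\}\in\mathcal{B}$ and $(B'\cup\{e\})\setminus\{f\}\in\mathcal{B}$. Elements of $\mathcal{B}$ are bases. *)

theory Defs
  imports Complex_Main "HOL-Library.Function_Algebras" "HOL-Library.Product_Lexorder"
begin

text \<open>
  The element i of [n] is (False, i) and its partner i* is (True, i).  The lexicographic order
  on pairs, with False < True, is then 1 < ... < n < 1* < ... < n*.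
\<close>

type_synonym elt = "bool \<times> nat"

definition ground :: "nat \<Rightarrow> elt set" where
  "ground n = UNIV \<times> {1..n}"

definition star :: "elt \<Rightarrow> elt" where
  "star e = (\<not> fst e, snd e)"

definition skew_pair :: "nat \<Rightarrow> elt set" where
  "skew_pair i = {(False, i), star (False, i)}"

definition skew_pairs :: "nat \<Rightarrow> elt set set" where
  "skew_pairs n = skew_pair ` {1..n}"

definition skew_pairs_in :: "nat \<Rightarrow> elt set \<Rightarrow> elt set set" where
  "skew_pairs_in n S = {p \<in> skew_pairs n. p \<subseteq> S}"

definition transversals :: "nat \<Rightarrow> elt set set" where
  "transversals n = {B. B \<subseteq> ground n \<and> card B = n \<and> skew_pairs_in n B = {}}"

definition almost_transversals :: "nat \<Rightarrow> elt set set" where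
  "almost_transversals n = {B. B \<subseteq> ground n \<and> card B = n \<and> card (skew_pairs_in n B) = 1}"

definition subtransversal :: "nat \<Rightarrow> elt set \<Rightarrow> bool" where
  "subtransversal n S \<longleftrightarrow> (\<exists>T \<in> transversals n. S \<subseteq> T)"

definition sigma :: "elt set \<Rightarrow> elt \<Rightarrow> nat" where
  "sigma S e = card {y \<in> S. y < e}"

text \<open>
  Vectors of homogeneous coordinates.  Since they are total functions on sets of elements, they
  are required to vanish off the actual index set, so that distinct vectors differ in some
  coordinate.
\<close>

definition coord_space :: "nat \<Rightarrow> (elt set \<Rightarrow> 'k::field) set" where
  "coord_space n = {x.
     (\<forall>B. B \<notin> transversals n \<union> almost_transversals n \<longrightarrow> x B = 0) \<and>
     (\<forall>S i j. subtransversal n S \<and> card S + 2 = n \<and> i \<in> {1..n} \<and> j \<in> {1..n} \<and> i \<noteq> j \<and>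
        skew_pair i \<inter> S = {} \<and> skew_pair j \<inter> S = {} \<longrightarrow>
        (-1) ^ i * x (S \<union> skew_pair i) = (-1) ^ j * x (S \<union> skew_pair j))}"

definition scale_fun :: "'k::field \<Rightarrow> ('a \<Rightarrow> 'k) \<Rightarrow> 'a \<Rightarrow> 'k" where
  "scale_fun c x = (\<lambda>B. c * x B)"

definition proportional :: "(('a \<Rightarrow> 'k::field) \<times> ('a \<Rightarrow> 'k)) set" where
  "proportional = {(x, y). \<exists>c. c \<noteq> 0 \<and> y = scale_fun c x}"

definition projective_space :: "nat \<Rightarrow> (elt set \<Rightarrow> 'k::field) set set" where
  "projective_space n = (coord_space n - {0}) // proportional"

definition restricted_GP_indices :: "nat \<Rightarrow> (elt set \<times> elt set) set" where
  "restricted_GP_indices n = {(S, T).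
     S \<subseteq> ground n \<and> card S = n + 1 \<and> card (skew_pairs_in n S) = 1 \<and>
     T \<subseteq> ground n \<and> card T + 1 = n \<and> skew_pairs_in n T = {}}"

definition GP_poly :: "elt set \<Rightarrow> elt set \<Rightarrow> (elt set \<Rightarrow> 'k::field) \<Rightarrow> 'k" where
  "GP_poly S T x = (\<Sum>e \<in> S - T. (-1) ^ (sigma S e + sigma T e) * x (S - {e}) * x (T \<union> {e}))"

definition satisfies_GP :: "(elt set \<Rightarrow> 'k::field) set \<Rightarrow> elt set \<Rightarrow> elt set \<Rightarrow> bool" where
  "satisfies_GP P S T \<longleftrightarrow> (\<forall>x \<in> P. GP_poly S T x = 0)"

definition point_support :: "nat \<Rightarrow> (elt set \<Rightarrow> 'k::field) set \<Rightarrow> elt set set" where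
  "point_support n P = {B \<in> transversals n \<union> almost_transversals n. \<forall>x \<in> P. x B \<noteq> 0}"

locale antisymmetric_matroid =
  fixes n :: nat and bases :: "elt set set"
  assumes bases_subset: "bases \<subseteq> transversals n \<union> almost_transversals n"
    and B1: "bases \<noteq> {}"
    and B2: "\<lbrakk>T \<in> transversals n; p \<in> skew_pairs n; q \<in> skew_pairs n; p \<noteq> q\<rbrakk> \<Longrightarrow>
      (T \<union> p) - q \<in> bases \<longleftrightarrow> (T \<union> q) - p \<in> bases"
    and Exch: "\<lbrakk>B \<in> bases; B' \<in> bases; e \<in> B - B'; skew_pairs_in n (B - {e}) = {};
      card (skew_pairs_in n (B' \<union> {e})) = 1\<rbrakk> \<Longrightarrow>
      \<exists>f \<in> B' - B. (B - {e}) \<union> {f} \<in> bases \<and> (B' \<union> {e}) - {f} \<in> bases"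

text \<open>
  Vanishing and non-vanishing of coordinates and relations do not depend on the representative.
\<close>

lemma projective_space_repr:
  assumes "P \<in> projective_space n" and "x \<in> P"
  shows "P = {scale_fun c x | c. c \<noteq> 0}"
proof -
  from assms obtain z where z: "P = proportional `` {z}"
    unfolding projective_space_def by (auto elim: quotientE)
  with assms obtain d where d: "d \<noteq> 0" "x = scale_fun d z"
    by (auto simp: proportional_def)
  have 1: "scale_fun c z = scale_fun (c / d) x" for c
    using d by (simp add: scale_fun_def)
  have 2: "scale_fun c x = scale_fun (c * d) z" for c
    using d by (simp add: scale_fun_def mult.assoc)
  have "scale_fun c z \<in> {scale_fun c x | c. c \<noteq> 0}" if "c \<noteq> 0" for c
    using 1[of c] d(1) that by (metis (mono_tags, lifting) divide_eq_0_iff mem_Collect_eq)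
  moreover have "scale_fun c x \<in> P" if "c \<noteq> 0" for c
    unfolding z proportional_def using 2[of c] d(1) that by (metis (mono_tags, lifting) ImageI case_prodI mem_Collect_eq mult_eq_0_iff singletonI)
  ultimately show ?thesis unfolding z proportional_def by blast
qed

lemma satisfies_GP_repr:
  assumes "P \<in> projective_space n" and "x \<in> P"
  shows "satisfies_GP P S T \<longleftrightarrow> GP_poly S T x = 0"
proof -
  have "GP_poly S T (scale_fun c x) = c\<^sup>2 * GP_poly S T x" for c
    by (simp add: GP_poly_def scale_fun_def sum_distrib_left power2_eq_square mult_ac)
  then show ?thesis
    using assms(2) by (auto simp: satisfies_GP_def projective_space_repr[OF assms])
qed

lemma point_support_repr:
  assumes "P \<in> projective_space n" and "x \<in> P"
  shows "point_support n P = {B \<in> transversals n \<union> almost_transversals n. x B \<noteq> 0}"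
  using assms(2) by (auto simp: point_support_def projective_space_repr[OF assms] scale_fun_def)

text \<open>
  The coordinate space has dimension 2 ^ (n - 2) (4 + (n choose 2)), so that the points form a
  projective space of dimension one less.  (In the term 2 ^ (n - 2) * (n choose 2) below, the
  truncated subtraction is harmless, as n choose 2 vanishes for n < 2.)
\<close>

lemma vector_space_scale_fun: "vector_space (scale_fun :: 'k::field \<Rightarrow> ('a \<Rightarrow> 'k) \<Rightarrow> 'a \<Rightarrow> 'k)"
  by unfold_locales (auto simp: scale_fun_def fun_eq_iff algebra_simps)

lemma dim_eq_card_pivots:
  fixes b :: "'j \<Rightarrow> 'a \<Rightarrow> 'k::field"
  assumes fin: "finite J"
    and sub: "module.subspace scale_fun V"
    and b: "\<And>j. j \<in> J \<Longrightarrow> b j \<in> V"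
    and piv: "\<And>j k. j \<in> J \<Longrightarrow> k \<in> J \<Longrightarrow> b j (piv k) = (if j = k then 1 else 0)"
    and ker: "\<And>x. x \<in> V \<Longrightarrow> (\<And>j. j \<in> J \<Longrightarrow> x (piv j) = 0) \<Longrightarrow> x = 0"
  shows "vector_space.dim scale_fun V = card J"
proof -
  interpret vs: vector_space "scale_fun :: 'k \<Rightarrow> ('a \<Rightarrow> 'k) \<Rightarrow> 'a \<Rightarrow> 'k"
    by (rule vector_space_scale_fun)
  have inj: "inj_on b J"
  proof (rule inj_onI)
    fix j k assume "j \<in> J" "k \<in> J" "b j = b k"
    with piv[of j k] piv[of k k] show "j = k" by (auto split: if_splits)
  qed
  have sum_app: "sum f A B = (\<Sum>a\<in>A. f a B)" for f :: "'j \<Rightarrow> 'a \<Rightarrow> 'k" and A B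
    by (induction A rule: infinite_finite_induct) auto
  have at_piv: "(\<Sum>j\<in>J. scale_fun (c j) (b j)) (piv k) = c k" if "k \<in> J" for c k
  proof -
    have "(\<Sum>j\<in>J. scale_fun (c j) (b j)) (piv k) = (\<Sum>j\<in>J. if j = k then c j else 0)"
      unfolding sum_app by (rule sum.cong) (auto simp: scale_fun_def piv that)
    then show ?thesis using that fin by simp
  qed
  have "vs.independent (b ` J)"
  proof (rule vs.independent_if_scalars_zero)
    show "finite (b ` J)" using fin by simp
    fix f x assume 0: "(\<Sum>x\<in>b ` J. scale_fun (f x) x) = 0" and "x \<in> b ` J"
    then obtain k where k: "k \<in> J" "x = b k" by auto
    have "(\<Sum>j\<in>J. scale_fun (f (b j)) (b j)) = 0"
      using 0 inj by (simp add: sum.reindex)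
    then show "f x = 0" using at_piv[OF k(1), of "\<lambda>j. f (b j)"] k by simp
  qed
  moreover have "V \<subseteq> vs.span (b ` J)"
  proof
    fix x assume x: "x \<in> V"
    define y where "y = (\<Sum>j\<in>J. scale_fun (x (piv j)) (b j))"
    have yV: "y \<in> V" unfolding y_def
      by (intro vs.subspace_sum[OF sub] vs.subspace_scale[OF sub] b)
    have "x - y = 0"
    proof (rule ker)
      show "x - y \<in> V" using vs.subspace_diff[OF sub x yV] .
      show "(x - y) (piv j) = 0" if "j \<in> J" for j
        using at_piv[OF that, of "\<lambda>j. x (piv j)"] by (simp add: y_def)
    qed
    then have "x = y" by simp
    also have "y \<in> vs.span (b ` J)" unfolding y_def
      by (intro vs.span_sum vs.span_scale vs.span_base) auto
    finally show "x \<in> vs.span (b ` J)" .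
  qed
  ultimately show ?thesis
    using vs.basis_card_eq_dim[of "b ` J" V] b card_image[OF inj] by (simp add: image_subset_iff)
qed

definition choice_set :: "nat set \<Rightarrow> nat set \<Rightarrow> elt set" where
  "choice_set M X = (\<lambda>i. (i \<in> X, i)) ` M"

lemma mem_choice_set: "(b, i) \<in> choice_set M X \<longleftrightarrow> i \<in> M \<and> (b \<longleftrightarrow> i \<in> X)"
  by (auto simp: choice_set_def)

lemma inj_on_choice_set: "inj_on (choice_set M) (Pow M)"
proof (rule inj_onI)
  fix X Y assume "X \<in> Pow M" "Y \<in> Pow M" and eq: "choice_set M X = choice_set M Y"
  moreover have "i \<in> X \<longleftrightarrow> i \<in> Y" if "i \<in> M" for i
  proof -
    have "(i \<in> X, i) \<in> choice_set M X" using that by (auto simp: choice_set_def)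
    then show ?thesis unfolding eq by (auto simp: choice_set_def)
  qed
  ultimately show "X = Y" by blast
qed

lemma skew_pair_eq: "skew_pair i = {(False, i), (True, i)}"
  by (simp add: skew_pair_def star_def)

lemma inj_skew_pair: "inj skew_pair"
  by (auto simp: inj_def skew_pair_eq)

lemma choice_set_skew_free:
  assumes "M \<subseteq> {1..n}"
  shows "choice_set M X \<subseteq> ground n" and "skew_pairs_in n (choice_set M X) = {}"
  using assms by (auto simp: ground_def skew_pairs_in_def skew_pairs_def skew_pair_eq choice_set_def)

lemma skew_freeE:
  assumes "S \<subseteq> ground n" and "skew_pairs_in n S = {}"
  obtains M X where "M \<subseteq> {1..n}" "X \<subseteq> M" "S = choice_set M X"
proof (rule that)
  have sub: "i \<in> {1..n}" if "(b, i) \<in> S" for b i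
    using assms(1) that by (auto simp: ground_def)
  have one: "\<not> ((False, i) \<in> S \<and> (True, i) \<in> S)" for i
  proof
    assume i: "(False, i) \<in> S \<and> (True, i) \<in> S"
    with sub have "skew_pair i \<in> skew_pairs_in n S"
      by (auto simp: skew_pairs_in_def skew_pairs_def skew_pair_eq)
    with assms(2) show False by simp
  qed
  show "snd ` S \<subseteq> {1..n}" using sub by force
  show "{i. (True, i) \<in> S} \<subseteq> snd ` S" by force
  have "(b, i) \<in> S \<longleftrightarrow> (b, i) \<in> choice_set (snd ` S) {i. (True, i) \<in> S}" for b i
  proof -
    have "i \<in> snd ` S \<longleftrightarrow> (False, i) \<in> S \<or> (True, i) \<in> S"
    proof
      assume "i \<in> snd ` S"
      then obtain c where "(c, i) \<in> S" by auto
      then show "(False, i) \<in> S \<or> (True, i) \<in> S" by (cases c) auto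
    qed force
    then show ?thesis unfolding mem_choice_set mem_Collect_eq using one[of i] by (cases b; simp only:; blast)
  qed
  then show "S = choice_set (snd ` S) {i. (True, i) \<in> S}"
    unfolding set_eq_iff split_paired_All by blast
qed

lemma card_choice_set: "card (choice_set M X) = card M"
  unfolding choice_set_def by (rule card_image) (auto simp: inj_on_def)

lemma transversals_eq: "transversals n = choice_set {1..n} ` Pow {1..n}"
proof (intro subset_antisym subsetI)
  fix B assume "B \<in> transversals n"
  then have B: "B \<subseteq> ground n" "card B = n" "skew_pairs_in n B = {}"
    by (simp_all add: transversals_def)
  obtain M X where MX: "M \<subseteq> {1..n}" "X \<subseteq> M" "B = choice_set M X"
    using skew_freeE[OF B(1,3)] .
  have "M = {1..n}"
    using MX(1) B(2) by (intro card_subset_eq) (simp_all add: MX(3) card_choice_set)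
  with MX show "B \<in> choice_set {1..n} ` Pow {1..n}" by blast
next
  fix B assume "B \<in> choice_set {1..n} ` Pow {1..n}"
  then obtain X where "B = choice_set {1..n} X" by blast
  then show "B \<in> transversals n"
    by (simp add: transversals_def card_choice_set choice_set_skew_free)
qed

definition linked :: "nat \<Rightarrow> elt set \<Rightarrow> nat \<Rightarrow> nat \<Rightarrow> bool" where
  "linked n S i j \<longleftrightarrow> subtransversal n S \<and> card S + 2 = n \<and> i \<in> {1..n} \<and> j \<in> {1..n} \<and> i \<noteq> j \<and>
     skew_pair i \<inter> S = {} \<and> skew_pair j \<inter> S = {}"

lemma linked_iff:
  "linked n S i j \<longleftrightarrow> i \<in> {1..n} \<and> j \<in> {1..n} \<and> i \<noteq> j \<and>
     S \<in> choice_set ({1..n} - {i, j}) ` Pow ({1..n} - {i, j})"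
proof (intro iffI)
  assume l: "linked n S i j"
  then obtain Y where Y: "S \<subseteq> choice_set {1..n} Y"
    by (auto simp: linked_def subtransversal_def transversals_eq)
  have "S \<subseteq> ground n" using Y choice_set_skew_free(1)[of "{1..n}" n Y] by blast
  moreover have "skew_pairs_in n S \<subseteq> skew_pairs_in n (choice_set {1..n} Y)"
    using Y by (auto simp: skew_pairs_in_def)
  then have "skew_pairs_in n S = {}" using choice_set_skew_free(2)[of "{1..n}" n Y] by simp
  ultimately obtain M X where MX: "M \<subseteq> {1..n}" "X \<subseteq> M" "S = choice_set M X"
    by (rule skew_freeE)
  have "i \<notin> M" "j \<notin> M"
    using l unfolding MX(3) by (auto simp: linked_def skew_pair_eq choice_set_def)
  with MX have sub: "M \<subseteq> {1..n} - {i, j}" by auto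
  have "card M + 2 = n" using l MX(3) by (simp add: linked_def card_choice_set)
  moreover have "card ({1..n} - {i, j}) = n - 2"
    using l by (subst card_Diff_subset) (auto simp: linked_def)
  ultimately have "M = {1..n} - {i, j}" using sub by (intro card_subset_eq) auto
  with MX(2,3) l show "i \<in> {1..n} \<and> j \<in> {1..n} \<and> i \<noteq> j \<and>
     S \<in> choice_set ({1..n} - {i, j}) ` Pow ({1..n} - {i, j})"
    by (auto simp: linked_def)
next
  assume "i \<in> {1..n} \<and> j \<in> {1..n} \<and> i \<noteq> j \<and>
     S \<in> choice_set ({1..n} - {i, j}) ` Pow ({1..n} - {i, j})"
  then obtain X where ij: "i \<in> {1..n}" "j \<in> {1..n}" "i \<noteq> j"
    and X: "X \<subseteq> {1..n} - {i, j}" "S = choice_set ({1..n} - {i, j}) X" by auto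
  have "card ({1..n} - {i, j}) = n - card {i, j}"
    using ij by (subst card_Diff_subset) auto
  moreover have "card {i, j} = 2" "2 \<le> n" using ij by auto
  ultimately have "card ({1..n} - {i, j}) + 2 = n" by arith
  then have "card S + 2 = n" using X(2) by (simp add: card_choice_set)
  moreover have "subtransversal n S"
    unfolding subtransversal_def transversals_eq using X
    by (intro bexI[of _ "choice_set {1..n} X"]) (auto simp: choice_set_def)
  ultimately show "linked n S i j"
    unfolding linked_def using ij X by (auto simp: linked_def skew_pair_eq choice_set_def)
qed

lemma linked_sym: "linked n S i j \<Longrightarrow> linked n S j i"
  by (auto simp: linked_def)

lemma linked_skew_pairs_in: "linked n S i j \<Longrightarrow> skew_pairs_in n (S \<union> skew_pair i) = {skew_pair i}"
  by (auto simp: linked_iff skew_pairs_in_def skew_pairs_def skew_pair_eq choice_set_def)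

lemma linked_almost:
  assumes "linked n S i j"
  shows "S \<union> skew_pair i \<in> almost_transversals n"
proof -
  have "S \<union> skew_pair i \<subseteq> ground n"
    using assms by (auto simp: linked_iff ground_def skew_pair_eq choice_set_def)
  moreover have "finite S" using assms by (auto simp: linked_iff choice_set_def)
  then have "card (S \<union> skew_pair i) = card S + card (skew_pair i)"
    using assms by (intro card_Un_disjoint) (auto simp: linked_def skew_pair_eq)
  then have "card (S \<union> skew_pair i) = n" using assms by (simp add: linked_def skew_pair_eq)
  ultimately show ?thesis
    by (simp add: almost_transversals_def linked_skew_pairs_in[OF assms])
qed

lemma linked_inj:
  assumes l: "linked n S i j" and l': "linked n S' i' j'" and eq: "S \<union> skew_pair i = S' \<union> skew_pair i'"
  shows "S = S' \<and> i = i' \<and> j = j'"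
proof -
  have i: "i = i'"
    using linked_skew_pairs_in[OF l] linked_skew_pairs_in[OF l'] eq inj_skew_pair
    by (simp add: inj_eq)
  with eq l l' have S: "S = S'" by (auto simp: linked_def)
  have "{1..n} - {i} - snd ` S = {j}" if "linked n S i j" for S i j
    using that by (auto simp: linked_iff choice_set_def image_iff)
  from this[OF l] this[OF l'] i S show ?thesis by simp
qed

lemma almost_linked:
  assumes "A \<in> almost_transversals n"
  shows "\<exists>S i j. linked n S i j \<and> A = S \<union> skew_pair i"
proof -
  from assms have A: "A \<subseteq> ground n" "card A = n" "card (skew_pairs_in n A) = 1"
    by (auto simp: almost_transversals_def)
  then obtain p where p: "skew_pairs_in n A = {p}" by (auto simp: card_1_singleton_iff)
  then obtain i where i: "i \<in> {1..n}" "p = skew_pair i" "skew_pair i \<subseteq> A"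
  proof -
    have "p \<in> skew_pairs_in n A" using p by simp
    then show thesis using that unfolding skew_pairs_in_def skew_pairs_def by auto
  qed
  have "A - skew_pair i \<subseteq> ground n" using A(1) by blast
  moreover have "skew_pairs_in n (A - skew_pair i) = {}"
  proof -
    have "q = skew_pair i" if "q \<in> skew_pairs_in n (A - skew_pair i)" for q
    proof -
      have "q \<in> skew_pairs_in n A" using that by (auto simp: skew_pairs_in_def)
      then show ?thesis using p i(2) by simp
    qed
    moreover have "skew_pair i \<notin> skew_pairs_in n (A - skew_pair i)"
      by (auto simp: skew_pairs_in_def skew_pair_eq)
    ultimately show ?thesis by blast
  qed
  ultimately obtain M X where MX: "M \<subseteq> {1..n}" "X \<subseteq> M" "A - skew_pair i = choice_set M X"
    by (rule skew_freeE)
  have iM: "i \<notin> M"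
  proof
    assume "i \<in> M"
    then have "(i \<in> X, i) \<in> A - skew_pair i" unfolding MX(3) by (auto simp: choice_set_def)
    then show False by (auto simp: skew_pair_eq)
  qed
  have fA: "finite A" using A(1) by (rule finite_subset) (simp add: ground_def)
  have "card (A - skew_pair i) = card A - 2" "card (skew_pair i) \<le> card A"
    using i(3) card_mono[OF fA i(3)] by (simp_all add: card_Diff_subset skew_pair_eq)
  then have cM: "card M + 2 = n" using A(2) MX(3) by (simp add: card_choice_set skew_pair_eq)
  have finM: "finite M" using MX(1) finite_subset by blast
  have "card ({1..n} - insert i M) = 1"
    using i MX(1) iM finM cM by (subst card_Diff_subset) auto
  then obtain j where j: "{1..n} - insert i M = {j}" by (rule card_1_singletonE)
  then have "j \<in> {1..n}" "j \<noteq> i" by blast+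
  moreover from j MX(1) iM have "M = {1..n} - {i, j}" by blast
  ultimately have "linked n (A - skew_pair i) i j" unfolding linked_iff using i(1) MX(2,3) by blast
  moreover have "A = (A - skew_pair i) \<union> skew_pair i" using i(3) by blast
  ultimately show ?thesis by blast
qed

lemma coord_space_alt:
  "x \<in> coord_space n \<longleftrightarrow>
     (\<forall>B. B \<notin> transversals n \<union> almost_transversals n \<longrightarrow> x B = 0) \<and>
     (\<forall>S i j. linked n S i j \<longrightarrow> (-1) ^ i * x (S \<union> skew_pair i) = (-1) ^ j * x (S \<union> skew_pair j))"
  by (simp add: coord_space_def linked_def)

lemma subspace_coord_space: "module.subspace scale_fun (coord_space n :: (elt set \<Rightarrow> 'k::field) set)"
proof -
  interpret vector_space "scale_fun :: 'k \<Rightarrow> (elt set \<Rightarrow> 'k) \<Rightarrow> elt set \<Rightarrow> 'k"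
    by (rule vector_space_scale_fun)
  show ?thesis
    by (rule subspaceI) (auto simp: coord_space_alt scale_fun_def distrib_left mult.left_commute)
qed

lemma card_ordered_pairs: "card (SIGMA j:{1..n}. {1..<j}) = n choose 2"
proof -
  have "card (SIGMA j:{1..n}. {1..<j}) = (\<Sum>j\<in>{1..n}. j - 1)" by simp
  also have "\<dots> = n choose 2"
    by (induction n) (auto simp: numeral_2_eq_2)
  finally show ?thesis .
qed

lemma card_linked: "card {(S, i, j). i < j \<and> linked n S i j} = 2 ^ (n - 2) * (n choose 2)"
proof -
  let ?I = "SIGMA (j, i):(SIGMA j:{1..n}. {1..<j}). Pow ({1..n} - {i, j})"
  let ?f = "\<lambda>((j, i), X). (choice_set ({1..n} - {i, j}) X, i, j)"
  have "inj_on ?f ?I"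
    by (auto simp: inj_on_def dest!: inj_onD[OF inj_on_choice_set])
  moreover have "?f ` ?I = {(S, i, j). i < j \<and> linked n S i j}"
  proof (intro subset_antisym subsetI)
    fix t assume "t \<in> {(S, i, j). i < j \<and> linked n S i j}"
    then obtain S i j where t: "t = (S, i, j)" "i < j" "linked n S i j" by (cases t) simp
    then obtain X where X: "X \<in> Pow ({1..n} - {i, j})" "S = choice_set ({1..n} - {i, j}) X"
      unfolding linked_iff by blast
    have "((j, i), X) \<in> ?I" using t X by (simp add: linked_iff)
    then show "t \<in> ?f ` ?I" by (rule rev_image_eqI) (simp add: t X)
  next
    fix t assume "t \<in> ?f ` ?I"
    then obtain i j X where "i \<in> {1..<j}" "j \<in> {1..n}" "X \<in> Pow ({1..n} - {i, j})"
      and "t = (choice_set ({1..n} - {i, j}) X, i, j)" by auto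
    then show "t \<in> {(S, i, j). i < j \<and> linked n S i j}" by (simp add: linked_iff)
  qed
  moreover have "card ?I = (\<Sum>(j, i)\<in>(SIGMA j:{1..n}. {1..<j}). 2 ^ (n - 2))"
  proof (subst card_SigmaI)
    show "(\<Sum>a\<in>(SIGMA j:{1..n}. {1..<j}). card (case a of (j, i) \<Rightarrow> Pow ({1..n} - {i, j}))) =
      (\<Sum>(j, i)\<in>(SIGMA j:{1..n}. {1..<j}). 2 ^ (n - 2))"
    proof (rule sum.cong[OF refl], clarify)
      fix j i assume "j \<in> {1..n}" "i \<in> {1..<j}"
      then show "card (Pow ({1..n} - {i, j})) = 2 ^ (n - 2)"
        by (auto simp: card_Pow card_Diff_subset)
    qed
  qed auto
  ultimately have "card {(S, i, j). i < j \<and> linked n S i j} =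
      (\<Sum>(j, i)\<in>(SIGMA j:{1..n}. {1..<j}). 2 ^ (n - 2))"
    by (metis (no_types, lifting) card_image)
  also have "\<dots> = (n choose 2) * 2 ^ (n - 2)"
    using card_ordered_pairs[of n] by (simp add: case_prod_unfold)
  finally show ?thesis by simp
qed

theorem dim_coord_space:
  "vector_space.dim scale_fun (coord_space n :: (elt set \<Rightarrow> 'k::field) set)
     = 2 ^ n + 2 ^ (n - 2) * (n choose 2)"
proof -
  let ?K = "{(S, i, j). i < j \<and> linked n S i j}"
  let ?J = "transversals n <+> ?K"
  define b :: "elt set + elt set \<times> nat \<times> nat \<Rightarrow> elt set \<Rightarrow> 'k" where
    "b = case_sum (\<lambda>T B. if B = T then 1 else 0)
       (\<lambda>(S, i, j) B. if B = S \<union> skew_pair i then 1 else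
          if B = S \<union> skew_pair j then (-1) ^ (i + j) else 0)"
  define piv :: "elt set + elt set \<times> nat \<times> nat \<Rightarrow> elt set" where
    "piv = case_sum id (\<lambda>(S, i, j). S \<union> skew_pair i)"
  have disj: "S \<union> skew_pair i \<notin> transversals n" if "linked n S i j" for S i j
    using linked_almost[OF that] by (auto simp: transversals_def almost_transversals_def)
  have fK: "finite ?K"
  proof (rule finite_subset)
    show "?K \<subseteq> Pow (ground n) \<times> {1..n} \<times> {1..n}"
      by (auto simp: linked_iff choice_set_def ground_def)
  qed (auto simp: ground_def)
  have fT: "finite (transversals n)" by (simp add: transversals_eq)
  have "vector_space.dim scale_fun (coord_space n :: (elt set \<Rightarrow> 'k) set) = card ?J"
  proof (rule dim_eq_card_pivots[where b = b and piv = piv])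
    show "finite ?J" using fK fT by simp
    show "module.subspace scale_fun (coord_space n :: (elt set \<Rightarrow> 'k) set)"
      by (rule subspace_coord_space)
    show "b k \<in> coord_space n" if k: "k \<in> ?J" for k
    proof (cases k)
      case (Inl T)
      then show ?thesis using that disj
        by (auto simp: coord_space_alt b_def dest: linked_sym)
    next
      case (Inr t)
      then obtain S i j where t: "k = Inr (S, i, j)" "i < j" "linked n S i j" using k by (cases t) auto
      note l = t(3) linked_sym[OF t(3)]
      have ne: "S \<union> skew_pair i \<noteq> S \<union> skew_pair j"
        using linked_inj[OF l] t(2) by auto
      have "(-1) ^ i' * b k (S' \<union> skew_pair i') = (-1) ^ j' * b k (S' \<union> skew_pair j')"
        if l': "linked n S' i' j'" for S' i' j'
      proof -
        note l'' = l' linked_sym[OF l']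
        consider "S' = S" "i' = i" "j' = j" | "S' = S" "i' = j" "j' = i"
          | "S' \<union> skew_pair i' \<noteq> S \<union> skew_pair i" "S' \<union> skew_pair i' \<noteq> S \<union> skew_pair j"
            "S' \<union> skew_pair j' \<noteq> S \<union> skew_pair i" "S' \<union> skew_pair j' \<noteq> S \<union> skew_pair j"
          using linked_inj[OF l''(1) l(1)] linked_inj[OF l''(1) l(2)]
            linked_inj[OF l''(2) l(1)] linked_inj[OF l''(2) l(2)] by metis
        then show ?thesis
        proof cases
          case 1
          then show ?thesis using ne by (simp add: b_def t(1) power_add mult.left_commute flip: power_mult_distrib)
        next
          case 2
          then show ?thesis using ne by (simp add: b_def t(1) power_add mult.left_commute flip: power_mult_distrib)
        next
          case 3
          then show ?thesis by (simp add: b_def t(1))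
        qed
      qed
      moreover have "b k B = 0" if "B \<notin> transversals n \<union> almost_transversals n" for B
        using that linked_almost[OF l(1)] linked_almost[OF l(2)] by (auto simp: b_def t(1))
      ultimately show ?thesis by (auto simp: coord_space_alt)
    qed
    show "b k (piv m) = (if k = m then 1 else 0)" if km: "k \<in> ?J" "m \<in> ?J" for k m
    proof (cases k; cases m)
      fix T T' assume "k = Inl T" "m = Inl T'"
      then show ?thesis by (auto simp: b_def piv_def)
    next
      fix T t assume "k = Inl T" "m = Inr t"
      then show ?thesis using that disj by (auto simp: b_def piv_def)
    next
      fix T t assume "k = Inr t" "m = Inl T"
      then show ?thesis using that disj linked_sym
        by (auto simp: b_def piv_def) (metis disj linked_sym)+
    next
      fix t t' assume "k = Inr t" "m = Inr t'"
      then obtain S i j S' i' j' where k: "k = Inr (S, i, j)" "i < j" "linked n S i j"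
        and m: "m = Inr (S', i', j')" "i' < j'" "linked n S' i' j'" using km by (cases t; cases t') auto
      show ?thesis
        using linked_inj[OF m(3) k(3)] linked_inj[OF m(3) linked_sym[OF k(3)]] k m
        by (auto simp: b_def piv_def)
    qed
    show "x = 0" if x: "x \<in> coord_space n" and 0: "\<And>k. k \<in> ?J \<Longrightarrow> x (piv k) = 0"
      for x :: "elt set \<Rightarrow> 'k"
    proof
      fix B
      have T: "x T = 0" if "T \<in> transversals n" for T
        using 0[OF InlI[OF that]] by (simp add: piv_def)
      have lt: "x (S \<union> skew_pair i) = 0" if "linked n S i j" "i < j" for S i j
        using 0[of "Inr (S, i, j)"] that by (simp add: piv_def InrI)
      have "x (S \<union> skew_pair i) = 0" if l: "linked n S i j" for S i j
      proof (cases "i < j")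
        case False
        with l have "j < i" by (auto simp: linked_def)
        then have "x (S \<union> skew_pair j) = 0" using lt linked_sym[OF l] by blast
        moreover have "(-1) ^ i * x (S \<union> skew_pair i) = (-1) ^ j * x (S \<union> skew_pair j)"
          using x l unfolding coord_space_alt by blast
        ultimately show ?thesis by simp
      qed (use lt l in blast)
      then show "x B = 0 B"
        using T x almost_linked[of B n] unfolding coord_space_alt zero_fun_def by blast
    qed
  qed
  also have "card ?J = card (transversals n) + card ?K"
    by (rule card_Plus[OF fT fK])
  also have "card (transversals n) = 2 ^ n"
    by (simp add: transversals_eq card_image[OF inj_on_choice_set] card_Pow)
  finally show ?thesis by (simp only: card_linked)
qed

end

theory Submission
  imports Defs
begin

text \<open>
  For a skew-free set T of size n - 1, let row T be the vector on E with entries x (T + e), up to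
  sign.  By the antisymmetry of the coordinates, the restricted relation for S and T says that
  row T' and row T are orthogonal for a symplectic form on the space of vectors on E, where T' is S
  without its skew pair.  For a transversal basis B, the vectors row (B - i) with i in B are linearly
  independent and, by the local relations, pairwise orthogonal, so they span a Lagrangian subspace.
  The local relations also show that this subspace is the same for transversal bases which differ
  in at most two elements, and that it contains row T if T has all but at most two elements in B.
  The exchange axiom and (B2) connect any two transversal bases by steps of at most two elements,
  and every nonzero row T is close to a transversal basis.  Hence all the vectors row T lie in one
  Lagrangian subspace, so they are pairwise orthogonal.
\<close>

section \<open>Skew-free sets of size \<open>n - 1\<close> and the index sets of the restricted
  relations\<close>

lemma skew_pairs_in_eq:
  "skew_pairs_in n S = skew_pair ` {i \<in> {1..n}. (False, i) \<in> S \<and> (True, i) \<in> S}"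
  by (auto simp: skew_pairs_in_def skew_pairs_def skew_pair_eq)

lemma card_skew_pairs_in:
  "card (skew_pairs_in n S) = card {i \<in> {1..n}. (False, i) \<in> S \<and> (True, i) \<in> S}"
  unfolding skew_pairs_in_eq by (rule card_image) (use inj_skew_pair in \<open>auto simp: inj_on_def inj_def\<close>)

lemma finite_ground: "finite (ground n)"
  by (simp add: ground_def)

lemma choice_set_in_transversals: "choice_set {1..n} X \<in> transversals n"
  by (simp add: transversals_def card_choice_set choice_set_skew_free)

lemma hyperplaneE:
  assumes "T \<subseteq> ground n" "card T + 1 = n" "skew_pairs_in n T = {}"
  obtains m X where "m \<in> {1..n}" "T = choice_set ({1..n} - {m}) X"
proof -
  obtain M X where MX: "M \<subseteq> {1..n}" "X \<subseteq> M" "T = choice_set M X"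
    using skew_freeE[OF assms(1,3)] .
  have "card ({1..n} - M) = 1"
    using MX(1) assms(2) by (subst card_Diff_subset) (auto simp: MX(3) card_choice_set finite_subset)
  then obtain m where m: "{1..n} - M = {m}" by (rule card_1_singletonE)
  then have "m \<in> {1..n}" "M = {1..n} - {m}" using MX(1) by blast+
  with MX that show thesis by blast
qed

lemma choice_set_hyperplane:
  assumes "m \<in> {1..n}"
  shows "choice_set ({1..n} - {m}) X \<subseteq> ground n" "card (choice_set ({1..n} - {m}) X) + 1 = n"
    "skew_pairs_in n (choice_set ({1..n} - {m}) X) = {}"
  using assms choice_set_skew_free[of "{1..n} - {m}" n X] by (auto simp: card_choice_set)

text \<open>Removing the only skew pair leaves a skew-free set of size \<open>n - 1\<close>, and the
  index that it misses is the one of the removed pair.\<close>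

lemma one_skew_pairE:
  assumes "S \<subseteq> ground n" "card S = n + 1" "card (skew_pairs_in n S) = 1"
  obtains m X where "m \<in> {1..n}" "S = choice_set ({1..n} - {m}) X \<union> skew_pair m"
proof -
  obtain m where m: "{i \<in> {1..n}. (False, i) \<in> S \<and> (True, i) \<in> S} = {m}"
    using assms(3) unfolding card_skew_pairs_in by (rule card_1_singletonE)
  then have mn: "m \<in> {1..n}" "skew_pair m \<subseteq> S" by (auto simp: skew_pair_eq)
  have fin: "finite S" using assms(1) finite_ground by (rule finite_subset)
  have "card (S - skew_pair m) + 1 = n"
    using assms(2) mn fin by (subst card_Diff_subset) (auto simp: skew_pair_eq)
  moreover have "skew_pairs_in n (S - skew_pair m) = {}"
    using m by (auto simp: skew_pairs_in_eq skew_pair_eq)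
  ultimately obtain m' X where m': "m' \<in> {1..n}" "S - skew_pair m = choice_set ({1..n} - {m'}) X"
    using assms(1) by (elim hyperplaneE[rotated]) auto
  have "m' = m"
  proof (rule ccontr)
    assume "m' \<noteq> m"
    with mn(1) have "(m \<in> X, m) \<in> S - skew_pair m" unfolding m'(2) by (simp add: mem_choice_set)
    then show False by (auto simp: skew_pair_eq)
  qed
  with m' mn that show thesis by blast
qed

lemma choice_set_union_skew_pair:
  assumes "m \<in> {1..n}"
  shows "choice_set ({1..n} - {m}) X \<union> skew_pair m \<subseteq> ground n"
    "card (choice_set ({1..n} - {m}) X \<union> skew_pair m) = n + 1"
    "card (skew_pairs_in n (choice_set ({1..n} - {m}) X \<union> skew_pair m)) = 1"
proof -
  let ?T = "choice_set ({1..n} - {m}) X"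
  show "?T \<union> skew_pair m \<subseteq> ground n"
    using assms by (auto simp: ground_def mem_choice_set skew_pair_eq)
  have "finite ?T" by (simp add: choice_set_def)
  then have "card (?T \<union> skew_pair m) = card ?T + card (skew_pair m)"
    by (rule card_Un_disjoint) (auto simp: skew_pair_eq mem_choice_set)
  then show "card (?T \<union> skew_pair m) = n + 1"
    using choice_set_hyperplane(2)[OF assms, of X] by (simp add: skew_pair_eq)
  have "{i \<in> {1..n}. (False, i) \<in> ?T \<union> skew_pair m \<and> (True, i) \<in> ?T \<union> skew_pair m} = {m}"
    using assms by (auto simp: skew_pair_eq mem_choice_set)
  then show "card (skew_pairs_in n (?T \<union> skew_pair m)) = 1" by (simp add: card_skew_pairs_in)
qed

text \<open>Both index sets come from skew-free sets of size \<open>n - 1\<close>: \<open>S\<close>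
  is such a set enlarged by the skew pair that it misses. This common form lets a relation be read
  as a pairing of two \<open>row\<close> vectors.\<close>

lemma restricted_GP_indices_iff:
  "(S, T) \<in> restricted_GP_indices n \<longleftrightarrow> (\<exists>m X l Y. m \<in> {1..n} \<and> l \<in> {1..n} \<and>
     S = choice_set ({1..n} - {m}) X \<union> skew_pair m \<and> T = choice_set ({1..n} - {l}) Y)"
proof
  assume "(S, T) \<in> restricted_GP_indices n"
  then have "S \<subseteq> ground n" "card S = n + 1" "card (skew_pairs_in n S) = 1"
    "T \<subseteq> ground n" "card T + 1 = n" "skew_pairs_in n T = {}"
    by (auto simp: restricted_GP_indices_def)
  then show "\<exists>m X l Y. m \<in> {1..n} \<and> l \<in> {1..n} \<and>
     S = choice_set ({1..n} - {m}) X \<union> skew_pair m \<and> T = choice_set ({1..n} - {l}) Y"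
    by (meson hyperplaneE one_skew_pairE)
next
  assume "\<exists>m X l Y. m \<in> {1..n} \<and> l \<in> {1..n} \<and>
     S = choice_set ({1..n} - {m}) X \<union> skew_pair m \<and> T = choice_set ({1..n} - {l}) Y"
  then show "(S, T) \<in> restricted_GP_indices n"
    using choice_set_hyperplane choice_set_union_skew_pair
    by (elim exE conjE) (simp add: restricted_GP_indices_def)
qed

section \<open>Restricted relations as symplectic orthogonality\<close>

definition eps :: "elt \<Rightarrow> 'k::field" where
  "eps e = (if fst e then -1 else 1)"

text \<open>The standard symplectic form on vectors on E: \<open>star\<close> pairs the coordinates,
  and \<open>eps\<close> gives the two members of a skew pair opposite signs.\<close>

definition omega :: "nat \<Rightarrow> (elt \<Rightarrow> 'k::field) \<Rightarrow> (elt \<Rightarrow> 'k) \<Rightarrow> 'k" where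
  "omega n u v = (\<Sum>e\<in>ground n. eps e * u (star e) * v e)"

text \<open>The sign is the factor of the sign in a relation that belongs to \<open>T\<close>. The
  value 0 on \<open>T\<close> removes these elements when a sum over \<open>S - T\<close> is
  extended to \<open>ground n\<close>.\<close>

definition row :: "(elt set \<Rightarrow> 'k::field) \<Rightarrow> elt set \<Rightarrow> elt \<Rightarrow> 'k" where
  "row x T e = (if e \<in> T then 0 else (-1) ^ sigma T e * x (T \<union> {e}))"

lemma star_star [simp]: "star (star e) = e"
  by (simp add: star_def)

lemma star_ground: "star e \<in> ground n \<longleftrightarrow> e \<in> ground n"
  by (auto simp: star_def ground_def mem_Times_iff)

lemma omega_skew: "omega n u v = - omega n v u"
proof -
  have "omega n u v = (\<Sum>e\<in>ground n. eps (star e) * u e * v (star e))"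
    unfolding omega_def
    by (rule sum.reindex_bij_witness[of _ star star]) (auto simp: star_ground)
  also have "\<dots> = - omega n v u"
    unfolding omega_def sum_negf[symmetric]
    by (rule sum.cong) (auto simp: eps_def star_def)
  finally show ?thesis .
qed

lemma omega_sum_left:
  "omega n (\<lambda>e. \<Sum>i\<in>I. c i * w i e) v = (\<Sum>i\<in>I. c i * omega n (w i) v)"
  unfolding omega_def sum_distrib_left sum_distrib_right
  by (subst sum.swap) (simp add: mult_ac)

lemma omega_diff_left: "omega n (\<lambda>e. u e - u' e) v = omega n u v - omega n u' v"
  by (simp add: omega_def algebra_simps sum_subtractf)

text \<open>Every unstarred element is below every starred one. Hence all of the unstarred part,
  indexed by \<open>M - X\<close>, lies below \<open>(True, i)\<close>, while the elements with
  index below \<open>i\<close> are counted once: the starred ones at \<open>(True, i)\<close>, the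
  unstarred ones at \<open>(False, i)\<close>.\<close>

lemma sigma_choice_set:
  assumes "finite M"
  shows "sigma (choice_set M X) (b, i) + sigma (choice_set M X) (\<not> b, i) = card (M - X) + card {j \<in> M. j < i}"
proof -
  have inj: "card {y \<in> choice_set M X. P y} = card {j \<in> M. P (j \<in> X, j)}" for P
  proof -
    have "{y \<in> choice_set M X. P y} = (\<lambda>j. (j \<in> X, j)) ` {j \<in> M. P (j \<in> X, j)}"
      by (auto simp: choice_set_def)
    then show ?thesis by (simp add: card_image inj_on_def)
  qed
  have F: "sigma (choice_set M X) (False, i) = card {j \<in> M. j \<notin> X \<and> j < i}"
    unfolding sigma_def inj by (rule arg_cong[where f = card]) auto
  have T: "sigma (choice_set M X) (True, i) = card ((M - X) \<union> {j \<in> M. j \<in> X \<and> j < i})"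
    unfolding sigma_def inj by (rule arg_cong[where f = card]) auto
  have T': "card ((M - X) \<union> {j \<in> M. j \<in> X \<and> j < i}) = card (M - X) + card {j \<in> M. j \<in> X \<and> j < i}"
    using assms by (intro card_Un_disjoint) auto
  have "card {j \<in> M. j < i} = card ({j \<in> M. j \<notin> X \<and> j < i} \<union> {j \<in> M. j \<in> X \<and> j < i})"
    by (rule arg_cong[where f = card]) auto
  also have "\<dots> = card {j \<in> M. j \<notin> X \<and> j < i} + card {j \<in> M. j \<in> X \<and> j < i}"
    using assms by (intro card_Un_disjoint) auto
  finally show ?thesis using F T T' by (cases b) simp_all
qed

text \<open>The sign count for \<open>GP_poly_eq_omega\<close>: apart from a constant, the parity
  depends only on \<open>i\<close>, which \<open>coord_union_skew_pair\<close> absorbs, and on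
  \<open>b\<close>, which \<open>eps\<close> absorbs.\<close>

lemma sigma_union_skew_pair:
  assumes "m \<in> {1..n}" "i \<in> {1..n}"
  shows "sigma (choice_set ({1..n} - {m}) X \<union> skew_pair m) (b, i) + sigma (choice_set ({1..n} - {m}) X) (\<not> b, i) + 1
    = card ({1..n} - {m} - X) + i + of_bool b"
proof -
  let ?M = "{1..n} - {m}"
  have "sigma (choice_set ?M X \<union> skew_pair m) (b, i) =
    card ({y \<in> choice_set ?M X. y < (b, i)} \<union> {y \<in> skew_pair m. y < (b, i)})"
    unfolding sigma_def by (rule arg_cong[where f = card]) auto
  also have "\<dots> = sigma (choice_set ?M X) (b, i) + card {y \<in> skew_pair m. y < (b, i)}"
    unfolding sigma_def
    by (rule card_Un_disjoint) (auto simp: choice_set_def skew_pair_eq)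
  also have "{y \<in> skew_pair m. y < (b, i)} =
      (if m < i then {(b, m)} else {}) \<union> (if b then {(False, m)} else {})"
    by (cases b) (auto simp: skew_pair_eq)
  also have "card \<dots> = of_bool (m < i) + of_bool b" by auto
  finally have 1: "sigma (choice_set ?M X \<union> skew_pair m) (b, i) =
      sigma (choice_set ?M X) (b, i) + (of_bool (m < i) + of_bool b)" .
  \<comment> \<open>As \<open>m\<close> is absent from \<open>?M\<close>, it has to be added when
    \<open>m < i\<close> to reach all \<open>i - 1\<close> smaller indices. The skew pair supplies
    exactly this \<open>of_bool (m < i)\<close> in the count above.\<close>
  have "{1..<i} = {j \<in> ?M. j < i} \<union> (if m < i then {m} else {})" using assms by auto
  then have "i - 1 = card ({j \<in> ?M. j < i} \<union> (if m < i then {m} else {}))"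
    by (metis card_atLeastLessThan)
  also have "\<dots> = card {j \<in> ?M. j < i} + of_bool (m < i)" by auto
  finally have 2: "card {j \<in> ?M. j < i} + of_bool (m < i) + 1 = i"
    using assms by (simp only: atLeastAtMost_iff) linarith
  show ?thesis using 1 2 sigma_choice_set[of ?M X b i] by simp
qed

text \<open>For \<open>i = m\<close> the two sets coincide. Otherwise they are one subtransversal of
  size \<open>n - 2\<close> together with the skew pair of \<open>m\<close> or of \<open>i\<close>,
  and the defining relation of the coordinates applies.\<close>

lemma coord_union_skew_pair:
  fixes x :: "elt set \<Rightarrow> 'k::field"
  assumes x: "x \<in> coord_space n" and m: "m \<in> {1..n}"
    and e: "(b, i) \<in> choice_set ({1..n} - {m}) X \<union> skew_pair m"
  shows "(-1) ^ m * x (choice_set ({1..n} - {m}) X \<union> skew_pair m - {(b, i)}) =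
    (-1) ^ i * x (choice_set ({1..n} - {m}) X \<union> {(\<not> b, i)})"
proof (cases "i = m")
  case True
  then have "choice_set ({1..n} - {m}) X \<union> skew_pair m - {(b, i)} = choice_set ({1..n} - {m}) X \<union> {(\<not> b, i)}"
    by (cases b) (auto simp: skew_pair_eq mem_choice_set)
  with True show ?thesis by simp
next
  case False
  with e have i: "i \<in> {1..n}" "b \<longleftrightarrow> i \<in> X" by (auto simp: skew_pair_eq mem_choice_set)
  let ?A = "choice_set ({1..n} - {m, i}) X"
  have "?A = choice_set ({1..n} - {m, i}) (X \<inter> ({1..n} - {m, i}))"
    by (auto simp: choice_set_def)
  with i m False have "linked n ?A m i" unfolding linked_iff by blast
  then have "(-1) ^ m * x (?A \<union> skew_pair m) = (-1) ^ i * x (?A \<union> skew_pair i)"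
    using x unfolding coord_space_alt by blast
  moreover have "?A \<union> skew_pair m = choice_set ({1..n} - {m}) X \<union> skew_pair m - {(b, i)}"
    using False i by (auto simp: skew_pair_eq mem_choice_set)
  moreover have "?A \<union> skew_pair i = choice_set ({1..n} - {m}) X \<union> {(\<not> b, i)}"
    using False i by (auto simp: skew_pair_eq mem_choice_set)
  ultimately show ?thesis by simp
qed

text \<open>
  The antisymmetry of the coordinates identifies the coefficient vector of S with the conjugate of
  the one of the skew-free part of S, so that a restricted relation becomes a symplectic pairing.
\<close>

lemma GP_poly_eq_omega:
  fixes x :: "elt set \<Rightarrow> 'k::field" and X :: "nat set"
  assumes x: "x \<in> coord_space n" and m: "m \<in> {1..n}" and T: "T \<subseteq> ground n"
  defines "T' \<equiv> choice_set ({1..n} - {m}) X"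
  shows "GP_poly (T' \<union> skew_pair m) T x =
    (-1) ^ (card ({1..n} - {m} - X) + m + 1) * omega n (row x T') (row x T)"
proof -
  let ?S = "T' \<union> skew_pair m" and ?c = "(-1) ^ (card ({1..n} - {m} - X) + m + 1) :: 'k"
  have S: "?S \<subseteq> ground n" unfolding T'_def by (rule choice_set_union_skew_pair(1)[OF m])
  have key: "(-1) ^ sigma ?S e * x (?S - {e}) = ?c * (eps e * row x T' (star e))" if e: "e \<in> ?S" for e
  proof -
    obtain b i where bi: "e = (b, i)" by (cases e)
    have i: "i \<in> {1..n}" using e S bi by (auto simp: ground_def)
    have nin: "(\<not> b, i) \<notin> T'" using e bi unfolding T'_def by (auto simp: mem_choice_set skew_pair_eq)
    have r: "row x T' (star e) = (-1) ^ sigma T' (\<not> b, i) * x (T' \<union> {(\<not> b, i)})"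
      using nin by (simp add: row_def bi star_def)
    have xe: "x (?S - {e}) = (-1) ^ (m + i) * x (T' \<union> {(\<not> b, i)})"
    proof -
      have sq: "(-1::'k) ^ m * (-1) ^ m = 1" by (simp flip: power_mult_distrib)
      have "x (?S - {e}) = (-1) ^ m * ((-1) ^ m * x (?S - {e}))"
        by (simp only: mult.assoc[symmetric] sq mult_1)
      also have "(-1) ^ m * x (?S - {e}) = (-1) ^ i * x (T' \<union> {(\<not> b, i)})"
        using coord_union_skew_pair[OF x m, of b i X] e unfolding T'_def bi by simp
      finally show ?thesis by (simp only: power_add mult.assoc)
    qed
    have s: "sigma ?S e + sigma T' (\<not> b, i) + 1 = card ({1..n} - {m} - X) + i + of_bool b"
      unfolding bi T'_def by (rule sigma_union_skew_pair[OF m i])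
    \<comment> \<open>Only parities matter for the signs, so the terms of \<open>s\<close> may
      change sides.\<close>
    have "even (sigma ?S e + (m + i)) \<longleftrightarrow>
      even (card ({1..n} - {m} - X) + m + 1 + of_bool b + sigma T' (\<not> b, i))"
      using arg_cong[OF s, of even] by (auto simp: even_add)
    then have "(-1::'k) ^ (sigma ?S e + (m + i)) =
      (-1) ^ (card ({1..n} - {m} - X) + m + 1 + of_bool b + sigma T' (\<not> b, i))"
      by (simp only: minus_one_power_iff)
    moreover have "eps e = (-1::'k) ^ of_bool b" by (simp add: eps_def bi)
    moreover have "(-1) ^ sigma ?S e * x (?S - {e}) = (-1) ^ (sigma ?S e + (m + i)) * x (T' \<union> {(\<not> b, i)})"
      unfolding xe by (simp only: power_add mult.assoc)
    ultimately show ?thesis unfolding r by (simp only: power_add mult.assoc)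
  qed
  \<comment> \<open>Outside \<open>?S\<close> the partner of \<open>e\<close> lies in
    \<open>T'\<close>, so extending the sum to \<open>ground n\<close> adds only zeros.\<close>
  have zero: "row x T' (star e) = 0" if "e \<in> ground n" "e \<notin> ?S" for e
  proof -
    obtain b i where bi: "e = (b, i)" by (cases e)
    have "(\<not> b, i) \<in> T'"
      using that unfolding T'_def bi by (auto simp: ground_def mem_choice_set skew_pair_eq)
    then show ?thesis by (simp add: row_def bi star_def)
  qed
  have "GP_poly ?S T x = (\<Sum>e\<in>?S - T. ((-1) ^ sigma ?S e * x (?S - {e})) * row x T e)"
    unfolding GP_poly_def by (rule sum.cong) (auto simp: row_def power_add)
  also have "\<dots> = (\<Sum>e\<in>?S - T. ?c * (eps e * row x T' (star e)) * row x T e)"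
    by (rule sum.cong) (use key in auto)
  also have "\<dots> = (\<Sum>e\<in>ground n. ?c * (eps e * row x T' (star e)) * row x T e)"
  proof (rule sum.mono_neutral_left)
    show "\<forall>e\<in>ground n - (?S - T). ?c * (eps e * row x T' (star e)) * row x T e = 0"
      using zero by (auto simp: row_def[of x T])
  qed (use finite_ground S in auto)
  also have "\<dots> = ?c * omega n (row x T') (row x T)"
    unfolding omega_def sum_distrib_left by (simp add: mult.assoc)
  finally show ?thesis .
qed

lemma GP_poly_eq_0_iff:
  assumes "x \<in> coord_space n" and "m \<in> {1..n}" and "T \<subseteq> ground n"
  shows "GP_poly (choice_set ({1..n} - {m}) X \<union> skew_pair m) T x = 0 \<longleftrightarrow>
    omega n (row x (choice_set ({1..n} - {m}) X)) (row x T) = 0"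
  unfolding GP_poly_eq_omega[OF assms] by simp

text \<open>
  The vectors w i are a basis of a Lagrangian subspace, whose orthogonal complement is itself.
\<close>

lemma lagrangian_orthogonal:
  fixes u v :: "elt \<Rightarrow> 'k::field" and w :: "elt \<Rightarrow> elt \<Rightarrow> 'k"
  assumes diag: "\<And>i. i \<in> choice_set {1..n} X \<Longrightarrow> w i i \<noteq> 0"
    and off: "\<And>i j. i \<in> choice_set {1..n} X \<Longrightarrow> j \<in> choice_set {1..n} X \<Longrightarrow> i \<noteq> j \<Longrightarrow> w i j = 0"
    and iso: "\<And>i j. i \<in> choice_set {1..n} X \<Longrightarrow> j \<in> choice_set {1..n} X \<Longrightarrow> omega n (w i) (w j) = 0"
    and u: "\<And>i. i \<in> choice_set {1..n} X \<Longrightarrow> omega n u (w i) = 0"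
    and v: "\<And>i. i \<in> choice_set {1..n} X \<Longrightarrow> omega n v (w i) = 0"
  shows "omega n u v = 0"
proof -
  let ?B = "choice_set {1..n} X"
  \<comment> \<open>On \<open>?B\<close> the vectors \<open>w i\<close> are diagonal, which forces
    these coefficients if the remainder \<open>r\<close> is to vanish on \<open>?B\<close>.\<close>
  define c where "c i = u i / w i i" for i
  define r where "r e = u e - (\<Sum>i\<in>?B. c i * w i e)" for e
  have fin: "finite ?B" by (simp add: choice_set_def)
  have B: "?B \<subseteq> ground n" by (simp add: choice_set_skew_free)
  have rB: "r j = 0" if j: "j \<in> ?B" for j
  proof -
    have "(\<Sum>i\<in>?B. c i * w i j) = (\<Sum>i\<in>?B. if i = j then u j else 0)"
      by (rule sum.cong) (use diag off j in \<open>auto simp: c_def\<close>)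
    then show ?thesis using j fin by (simp add: r_def)
  qed
  have r_perp: "omega n r (w j) = 0" if "j \<in> ?B" for j
    unfolding r_def omega_diff_left omega_sum_left using that u iso by simp
  have mem: "e \<in> ?B \<or> star e \<in> ?B" if "e \<in> ground n" for e
    using that by (cases e) (auto simp: ground_def star_def mem_choice_set)
  \<comment> \<open>Pairing \<open>r\<close> with \<open>w j\<close> isolates
    \<open>r (star j)\<close>: at any other \<open>e\<close> in \<open>?B\<close> the vector
    \<open>w j\<close> vanishes, and for \<open>e\<close> outside \<open>?B\<close> its partner is
    in \<open>?B\<close>, where \<open>r\<close> vanishes.\<close>
  have rstar: "r (star j) = 0" if j: "j \<in> ?B" for j
  proof -
    have "omega n r (w j) = (\<Sum>e\<in>ground n. if e = j then eps j * r (star j) * w j j else 0)"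
      unfolding omega_def
    proof (rule sum.cong[OF refl])
      fix e assume e: "e \<in> ground n"
      show "eps e * r (star e) * w j e = (if e = j then eps j * r (star j) * w j j else 0)"
        using mem[OF e] rB[of "star e"] off[of j e] j by (cases "e \<in> ?B") auto
    qed
    also have "\<dots> = eps j * r (star j) * w j j" using j B finite_ground by auto
    finally show ?thesis using r_perp[OF j] diag[OF j] by (auto simp: eps_def split: if_splits)
  qed
  have r0: "r e = 0" if "e \<in> ground n" for e
    using mem[OF that] rB[of e] rstar[of "star e"] by auto
  have "omega n u v = omega n r v + (\<Sum>i\<in>?B. c i * omega n (w i) v)"
    unfolding r_def omega_diff_left omega_sum_left by simp
  also have "omega n r v = 0" by (simp add: omega_def r0 star_ground)
  also have "(\<Sum>i\<in>?B. c i * omega n (w i) v) = 0"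
    by (rule sum.neutral) (use v omega_skew[of n _ v] in auto)
  finally show ?thesis by simp
qed

section \<open>Exchange between transversal bases\<close>

lemma choice_set_pair:
  assumes "i \<noteq> j" "i \<in> {1..n}" "j \<in> {1..n}"
  shows "choice_set ({1..n} - {i, j}) X \<union> {(b, i), (c, j)} =
    choice_set {1..n} ((X - {i, j}) \<union> (if b then {i} else {}) \<union> (if c then {j} else {}))"
  using assms by (cases b; cases c; auto simp: mem_choice_set)

context antisymmetric_matroid
begin

lemma skew_pair_swap:
  assumes ij: "i \<noteq> j" "i \<in> {1..n}" "j \<in> {1..n}"
    and "choice_set ({1..n} - {i, j}) X \<union> skew_pair i \<in> bases"
  shows "choice_set ({1..n} - {i, j}) X \<union> skew_pair j \<in> bases"
proof -
  let ?A = "choice_set ({1..n} - {i, j}) X"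
  \<comment> \<open>Any transversal containing \<open>?A\<close> serves for (B2): each of its two
    further elements lies in one of the two skew pairs, of which one is added and the other
    removed.\<close>
  let ?T = "?A \<union> {(False, i), (False, j)}"
  have "?T \<in> transversals n" unfolding choice_set_pair[OF ij] by (rule choice_set_in_transversals)
  then have "(?T \<union> skew_pair i) - skew_pair j \<in> bases \<longleftrightarrow> (?T \<union> skew_pair j) - skew_pair i \<in> bases"
    using ij inj_skew_pair by (intro B2) (auto simp: skew_pairs_def inj_def)
  moreover have "(?T \<union> skew_pair i) - skew_pair j = ?A \<union> skew_pair i"
    "(?T \<union> skew_pair j) - skew_pair i = ?A \<union> skew_pair j"
    using ij by (auto simp: skew_pair_eq mem_choice_set)
  ultimately show ?thesis using assms(4) by simp
qed

text \<open>The basis and its swap by (B2) differ only in the pairs of \<open>i\<close> and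
  \<open>j\<close>. Exchanging \<open>(\<not> b, i)\<close> between them must therefore bring in an
  element of the pair of \<open>j\<close>, which breaks up the skew pair.\<close>

lemma exists_transversal_basis:
  assumes ij: "i \<noteq> j" "i \<in> {1..n}" "j \<in> {1..n}"
    and basis: "choice_set ({1..n} - {i, j}) X \<union> skew_pair i \<in> bases"
  shows "\<exists>c. choice_set ({1..n} - {i, j}) X \<union> {(b, i), (c, j)} \<in> bases"
proof -
  let ?A = "choice_set ({1..n} - {i, j}) X"
  have "skew_pairs_in n (?A \<union> skew_pair i - {(\<not> b, i)}) = {}"
    by (auto simp: skew_pairs_in_eq skew_pair_eq mem_choice_set)
  moreover have "{l \<in> {1..n}. (False, l) \<in> (?A \<union> skew_pair j) \<union> {(\<not> b, i)} \<and>
      (True, l) \<in> (?A \<union> skew_pair j) \<union> {(\<not> b, i)}} = {j}"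
    using ij by (auto simp: skew_pair_eq mem_choice_set)
  then have "card (skew_pairs_in n ((?A \<union> skew_pair j) \<union> {(\<not> b, i)})) = 1"
    by (simp add: card_skew_pairs_in)
  moreover have "(\<not> b, i) \<in> (?A \<union> skew_pair i) - (?A \<union> skew_pair j)"
    using ij by (auto simp: skew_pair_eq mem_choice_set)
  ultimately obtain f where f: "f \<in> (?A \<union> skew_pair j) - (?A \<union> skew_pair i)"
    "(?A \<union> skew_pair i - {(\<not> b, i)}) \<union> {f} \<in> bases"
    using Exch[OF basis skew_pair_swap[OF ij basis]] by blast
  then obtain c where "f = (c, j)" by (auto simp: skew_pair_eq)
  moreover have "?A \<union> skew_pair i - {(\<not> b, i)} = ?A \<union> {(b, i)}"
    by (auto simp: skew_pair_eq mem_choice_set)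
  ultimately have "?A \<union> {(b, i), (c, j)} \<in> bases" using f(2) by (simp add: Un_insert_right insert_commute)
  then show ?thesis by blast
qed

text \<open>
  Transversal bases satisfy the symmetric exchange axiom of a delta-matroid: if the exchange leads
  to an almost-transversal, swapping its skew pair and exchanging once more gives a transversal.
\<close>

lemma transversal_step:
  assumes B: "choice_set {1..n} X \<in> bases" and B': "choice_set {1..n} Y \<in> bases"
    and ne: "choice_set {1..n} X \<noteq> choice_set {1..n} Y"
  shows "\<exists>Z. choice_set {1..n} Z \<in> bases \<and>
    card (choice_set {1..n} Z - choice_set {1..n} X) \<le> 2 \<and>
    card (choice_set {1..n} Z - choice_set {1..n} Y) < card (choice_set {1..n} X - choice_set {1..n} Y)"
proof -
  let ?B = "choice_set {1..n} X" and ?B' = "choice_set {1..n} Y"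
  have "\<exists>i\<in>{1..n}. \<not> (i \<in> X \<longleftrightarrow> i \<in> Y)"
  proof (rule ccontr)
    assume "\<not> ?thesis"
    then have "?B = ?B'" unfolding choice_set_def by (intro image_cong) auto
    with ne show False by blast
  qed
  then obtain i where i: "i \<in> {1..n}" "\<not> (i \<in> X \<longleftrightarrow> i \<in> Y)" by blast
  let ?e = "(i \<in> X, i)"
  have e: "?e \<in> ?B - ?B'" using i by (auto simp: mem_choice_set)
  have fin: "finite (?B - ?B')" by (simp add: choice_set_def)
  have closer: "card (Q - ?B') < card (?B - ?B')" if "Q - ?B' \<subseteq> (?B - ?B') - {?e}" for Q
    using that e fin by (intro psubset_card_mono) auto
  have "skew_pairs_in n (?B - {?e}) = {}"
    by (auto simp: skew_pairs_in_eq mem_choice_set)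
  moreover have "{l \<in> {1..n}. (False, l) \<in> ?B' \<union> {?e} \<and> (True, l) \<in> ?B' \<union> {?e}} = {i}"
    using i by (auto simp: mem_choice_set)
  then have "card (skew_pairs_in n (?B' \<union> {?e})) = 1"
    by (simp add: card_skew_pairs_in)
  ultimately obtain f where f: "f \<in> ?B' - ?B" "(?B - {?e}) \<union> {f} \<in> bases"
    using Exch[OF B B' e] by blast
  obtain c j where cj: "f = (c, j)" by (cases f)
  with f(1) have j: "j \<in> {1..n}" "\<not> (j \<in> X \<longleftrightarrow> j \<in> Y)" and "f = (j \<notin> X, j)"
    by (auto simp: mem_choice_set)
  note j = this(3) j
  show ?thesis
  proof (cases "j = i")
    case True
    define Z where "Z = (if i \<in> X then X - {i} else insert i X)"
    have Z: "choice_set {1..n} Z = (?B - {?e}) \<union> {f}"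
      using True i j by (auto simp: mem_choice_set Z_def)
    have "card (choice_set {1..n} Z - ?B) \<le> card {f}"
      unfolding Z by (rule card_mono) auto
    moreover have "card (choice_set {1..n} Z - ?B') < card (?B - ?B')"
      unfolding Z by (rule closer) (use f in auto)
    ultimately show ?thesis using f(2) Z by (intro exI[of _ Z]) simp
  next
    case False
    let ?A = "choice_set ({1..n} - {j, i}) X"
    \<comment> \<open>The exchange has produced an almost-transversal that contains the pair of
      \<open>j\<close> and misses the pair of \<open>i\<close>.\<close>
    have "(?B - {?e}) \<union> {f} = ?A \<union> skew_pair j"
      using False j i by (auto simp: mem_choice_set skew_pair_eq)
    with f(2) have "?A \<union> skew_pair j \<in> bases" by simp
    then have "choice_set ({1..n} - {i, j}) X \<union> skew_pair i \<in> bases"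
      using skew_pair_swap[OF False j(2) i(1)] by (simp add: insert_commute)
    \<comment> \<open>The element at \<open>i\<close> is prescribed to be the one of
      \<open>?B'\<close>. The value of \<open>c\<close> is not controlled, but \<open>(c, j)\<close>
      lies in \<open>?B\<close> or in \<open>?B'\<close>, so the distance to \<open>?B'\<close>
      still drops.\<close>
    then obtain c where c: "choice_set ({1..n} - {i, j}) X \<union> {(i \<notin> X, i), (c, j)} \<in> bases"
      using exists_transversal_basis[of i j X] False i j by blast
    define Z where "Z = (X - {i, j}) \<union> (if i \<notin> X then {i} else {}) \<union> (if c then {j} else {})"
    have Z: "choice_set {1..n} Z = choice_set ({1..n} - {i, j}) X \<union> {(i \<notin> X, i), (c, j)}"
      unfolding Z_def by (rule choice_set_pair[symmetric]) (use False i j in auto)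
    have "card (choice_set {1..n} Z - ?B) \<le> card {(i \<notin> X, i), (c, j)}"
      unfolding Z by (rule card_mono) (auto simp: mem_choice_set)
    also have "\<dots> \<le> 2" by (simp add: card_insert_if)
    finally have "card (choice_set {1..n} Z - ?B) \<le> 2" .
    moreover have "card (choice_set {1..n} Z - ?B') < card (?B - ?B')"
      unfolding Z by (rule closer) (use False i j in \<open>auto simp: mem_choice_set\<close>)
    ultimately show ?thesis using c Z by (intro exI[of _ Z]) simp
  qed
qed

end

section \<open>Local relations imply all relations\<close>

locale local_GP = antisymmetric_matroid n bases
  for n :: nat and bases :: "elt set set" +
  fixes x :: "elt set \<Rightarrow> 'k::field"
  assumes coord: "x \<in> coord_space n"
    and bases_eq: "bases = {B \<in> transversals n \<union> almost_transversals n. x B \<noteq> 0}"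
    and local_GP: "\<And>S T. (S, T) \<in> restricted_GP_indices n \<Longrightarrow> card (S - T) \<le> 4 \<Longrightarrow> GP_poly S T x = 0"
begin

lemma bases_iff: "B \<in> bases \<longleftrightarrow> x B \<noteq> 0"
  using coord unfolding bases_eq coord_space_alt by blast

text \<open>The orthogonal complement of the span of the rows at \<open>B\<close>. For a transversal
  basis this is the Lagrangian subspace itself, and membership is a list of local equations.\<close>

definition perp :: "elt set \<Rightarrow> (elt \<Rightarrow> 'k) set" where
  "perp B = {u. \<forall>i\<in>B. omega n u (row x (B - {i})) = 0}"

lemma choice_set_remove:
  assumes "i \<in> choice_set {1..n} X"
  shows "snd i \<in> {1..n}" "choice_set {1..n} X - {i} = choice_set ({1..n} - {snd i}) X"
  using assms by (cases i; auto simp: mem_choice_set)+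

text \<open>The source of the bound 4: adding the pair of \<open>m\<close> to the skew-free set and
  comparing with the transversal minus \<open>i\<close> leaves at most two elements from
  \<open>close\<close>, the element of the pair of \<open>m\<close> off the transversal, and
  \<open>i\<close>.\<close>

lemma row_in_perp:
  assumes m: "m \<in> {1..n}"
    and close: "card (choice_set ({1..n} - {m}) Y - choice_set {1..n} X) \<le> 2"
  shows "row x (choice_set ({1..n} - {m}) Y) \<in> perp (choice_set {1..n} X)"
  unfolding perp_def
proof safe
  let ?T = "choice_set ({1..n} - {m}) Y" and ?B = "choice_set {1..n} X"
  fix b i assume i: "(b, i) \<in> ?B"
  let ?e = "(b, i)"
  note ri = choice_set_remove[OF i]
  have "?T \<union> skew_pair m - (?B - {?e}) \<subseteq> (?T - ?B) \<union> {(m \<notin> X, m), ?e}"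
    using m by (auto simp: skew_pair_eq mem_choice_set)
  then have "card (?T \<union> skew_pair m - (?B - {?e})) \<le> card ((?T - ?B) \<union> {(m \<notin> X, m), ?e})"
    by (rule card_mono[rotated]) (simp add: choice_set_def)
  also have "\<dots> \<le> card (?T - ?B) + card {(m \<notin> X, m), ?e}" by (rule card_Un_le)
  also have "card {(m \<notin> X, m), ?e} \<le> 2" by (simp add: card_insert_if)
  then have "card (?T - ?B) + card {(m \<notin> X, m), ?e} \<le> 4" using close by linarith
  finally have "GP_poly (?T \<union> skew_pair m) (?B - {?e}) x = 0"
    using m ri by (intro local_GP) (auto simp: restricted_GP_indices_iff)
  moreover have "?B - {?e} \<subseteq> ground n" using choice_set_skew_free(1)[of "{1..n}" n X] by auto
  ultimately show "omega n (row x ?T) (row x (?B - {?e})) = 0"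
    using GP_poly_eq_0_iff[OF coord m] by blast
qed

text \<open>The rows at a transversal basis meet the hypotheses of
  \<open>lagrangian_orthogonal\<close>: the diagonal entries are the nonzero coordinate of the basis
  up to sign, and \<open>row_in_perp\<close> makes the rows pairwise orthogonal.\<close>

lemma perp_isotropic:
  assumes B: "choice_set {1..n} X \<in> bases"
    and u: "u \<in> perp (choice_set {1..n} X)" and v: "v \<in> perp (choice_set {1..n} X)"
  shows "omega n u v = 0"
proof (rule lagrangian_orthogonal[where X = X and w = "\<lambda>i. row x (choice_set {1..n} X - {i})"])
  let ?B = "choice_set {1..n} X" and ?w = "\<lambda>i. row x (choice_set {1..n} X - {i})"
  have w: "?w i \<in> perp ?B" if "i \<in> ?B" for i
  proof -
    have sub: "choice_set ({1..n} - {snd i}) X - ?B = {}" by (auto simp: mem_choice_set)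
    show ?thesis unfolding choice_set_remove(2)[OF that]
      by (rule row_in_perp[OF choice_set_remove(1)[OF that]]) (simp only: sub card.empty zero_le)
  qed
  show "?w i i \<noteq> 0" if "i \<in> ?B" for i
  proof -
    have "(?B - {i}) \<union> {i} = ?B" using that by blast
    then show ?thesis using B bases_iff by (simp add: row_def)
  qed
  show "?w i j = 0" if "i \<in> ?B" "j \<in> ?B" "i \<noteq> j" for i j
    using that by (simp add: row_def)
  show "omega n (?w i) (?w j) = 0" if "i \<in> ?B" "j \<in> ?B" for i j
    using w[OF that(1)] that(2) by (simp add: perp_def)
  show "omega n u (?w i) = 0" "omega n v (?w i) = 0" if "i \<in> ?B" for i
    using u v that by (simp_all add: perp_def)
qed

text \<open>Each row at the second transversal is close enough to the basis to lie in its
  \<open>perp\<close>, which is isotropic.\<close>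

lemma perp_mono:
  assumes B: "choice_set {1..n} X \<in> bases"
    and close: "card (choice_set {1..n} Z - choice_set {1..n} X) \<le> 2"
  shows "perp (choice_set {1..n} X) \<subseteq> perp (choice_set {1..n} Z)"
proof
  fix u assume u: "u \<in> perp (choice_set {1..n} X)"
  have "omega n u (row x (choice_set {1..n} Z - {i})) = 0" if i: "i \<in> choice_set {1..n} Z" for i
  proof (rule perp_isotropic[OF B u])
    have "card (choice_set ({1..n} - {snd i}) Z - choice_set {1..n} X) \<le> 2"
    proof (rule order_trans[OF card_mono close])
      show "choice_set ({1..n} - {snd i}) Z - choice_set {1..n} X \<subseteq> choice_set {1..n} Z - choice_set {1..n} X"
        by (auto simp: mem_choice_set)
    qed (simp add: choice_set_def)
    then show "row x (choice_set {1..n} Z - {i}) \<in> perp (choice_set {1..n} X)"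
      unfolding choice_set_remove(2)[OF i] using choice_set_remove(1)[OF i] by (rule row_in_perp[rotated])
  qed
  then show "u \<in> perp (choice_set {1..n} Z)" by (simp add: perp_def)
qed

text \<open>A chain of bases from \<open>transversal_step\<close> carries the inclusion of
  \<open>perp_mono\<close> from one basis to the other.\<close>

lemma perp_subset:
  assumes "choice_set {1..n} X \<in> bases" "choice_set {1..n} Y \<in> bases"
  shows "perp (choice_set {1..n} X) \<subseteq> perp (choice_set {1..n} Y)"
  using assms
proof (induction "card (choice_set {1..n} X - choice_set {1..n} Y)" arbitrary: X rule: less_induct)
  case less
  show ?case
  proof (cases "choice_set {1..n} X = choice_set {1..n} Y")
    case False
    then obtain Z where Z: "choice_set {1..n} Z \<in> bases"
      "card (choice_set {1..n} Z - choice_set {1..n} X) \<le> 2"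
      "card (choice_set {1..n} Z - choice_set {1..n} Y) < card (choice_set {1..n} X - choice_set {1..n} Y)"
      using transversal_step[OF less.prems] by blast
    have "perp (choice_set {1..n} X) \<subseteq> perp (choice_set {1..n} Z)"
      by (rule perp_mono[OF less.prems(1) Z(2)])
    also have "\<dots> \<subseteq> perp (choice_set {1..n} Y)" by (rule less.hyps[OF Z(3,1) less.prems(2)])
    finally show ?thesis .
  qed simp
qed

text \<open>A nonzero entry makes the set plus \<open>e\<close> a basis. If that basis is an
  almost-transversal, \<open>exists_transversal_basis\<close> repairs it at the cost of at most one
  element of the set.\<close>

lemma hyperplane_near_basis:
  assumes m: "m \<in> {1..n}" and nz: "row x (choice_set ({1..n} - {m}) Y) e \<noteq> 0"
  obtains X where "choice_set {1..n} X \<in> bases"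
    "card (choice_set ({1..n} - {m}) Y - choice_set {1..n} X) \<le> 2"
proof -
  let ?T = "choice_set ({1..n} - {m}) Y"
  obtain b i where bi: "e = (b, i)" by (cases e)
  have e: "(b, i) \<notin> ?T" "?T \<union> {(b, i)} \<in> bases"
    using nz by (auto simp: row_def bi bases_iff split: if_splits)
  then have "?T \<union> {(b, i)} \<subseteq> ground n"
    using bases_subset by (auto simp: transversals_def almost_transversals_def)
  then have i: "i \<in> {1..n}" by (auto simp: ground_def)
  show thesis
  proof (cases "i = m")
    case True
    have "?T \<union> {(b, i)} = choice_set {1..n} (if b then insert i Y else Y - {i})" (is "_ = ?B")
      using True i by (auto simp: mem_choice_set)
    moreover from this have "?T - ?B = {}" by blast
    ultimately show thesis using e(2) that by (metis card.empty le0)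
  next
    case False
    let ?A = "choice_set ({1..n} - {i, m}) Y"
    have "?T \<union> {(b, i)} = ?A \<union> skew_pair i"
      using e(1) False i by (auto simp: mem_choice_set skew_pair_eq)
    then obtain c where c: "?A \<union> {(b, i), (c, m)} \<in> bases"
      using e(2) exists_transversal_basis[OF False i m] by metis
    have "card (?T - (?A \<union> {(b, i), (c, m)})) \<le> card {(i \<in> Y, i)}"
      by (rule card_mono) (auto simp: mem_choice_set)
    then have "card (?T - (?A \<union> {(b, i), (c, m)})) \<le> 2" by simp
    with c show thesis unfolding choice_set_pair[OF False i m] by (rule that)
  qed
qed

text \<open>A nonzero row lies in the \<open>perp\<close> of some nearby transversal basis, and
  \<open>perp_subset\<close> transports it to the given one.\<close>

lemma row_in_perp_basis:
  assumes m: "m \<in> {1..n}" and Z: "choice_set {1..n} Z \<in> bases"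
  shows "row x (choice_set ({1..n} - {m}) Y) \<in> perp (choice_set {1..n} Z)"
proof (cases "\<exists>e. row x (choice_set ({1..n} - {m}) Y) e \<noteq> 0")
  case True
  then obtain X where "choice_set {1..n} X \<in> bases"
    "card (choice_set ({1..n} - {m}) Y - choice_set {1..n} X) \<le> 2"
    using hyperplane_near_basis[OF m] by blast
  with row_in_perp[OF m] perp_subset[OF _ Z] show ?thesis by blast
next
  case False
  then have "row x (choice_set ({1..n} - {m}) Y) = (\<lambda>_. 0)" by auto
  then show ?thesis by (simp add: perp_def omega_def)
qed

lemma transversal_basis_exists: "\<exists>X. choice_set {1..n} X \<in> bases"
proof -
  obtain B where B: "B \<in> bases" using B1 by blast
  show ?thesis
  proof (cases "B \<in> transversals n")
    case True
    then show ?thesis using B by (auto simp: transversals_eq)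
  next
    case False
    then obtain S i j where "linked n S i j" "B = S \<union> skew_pair i"
      using B bases_subset almost_linked by blast
    then obtain X where X: "i \<in> {1..n}" "j \<in> {1..n}" "i \<noteq> j" "choice_set ({1..n} - {i, j}) X \<union> skew_pair i \<in> bases"
      using B by (auto simp: linked_iff)
    then show ?thesis using exists_transversal_basis choice_set_pair by metis
  qed
qed

lemma all_GP:
  assumes "(S, T) \<in> restricted_GP_indices n"
  shows "GP_poly S T x = 0"
proof -
  obtain m X l Y where ml: "m \<in> {1..n}" "l \<in> {1..n}"
    and S: "S = choice_set ({1..n} - {m}) X \<union> skew_pair m" and T: "T = choice_set ({1..n} - {l}) Y"
    using assms unfolding restricted_GP_indices_iff by blast
  obtain Z where Z: "choice_set {1..n} Z \<in> bases" using transversal_basis_exists by blast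
  have "T \<subseteq> ground n" using choice_set_hyperplane(1)[OF ml(2)] T by simp
  moreover have "omega n (row x (choice_set ({1..n} - {m}) X)) (row x T) = 0"
    unfolding T by (rule perp_isotropic[OF Z]; rule row_in_perp_basis[OF _ Z]) (fact ml)+
  ultimately show ?thesis unfolding S using GP_poly_eq_0_iff[OF coord ml(1)] by blast
qed

end

section \<open>The support of a solution is an antisymmetric matroid\<close>

lemma antisymmetric_matroid_support:
  fixes x :: "elt set \<Rightarrow> 'k::field"
  assumes x: "x \<in> coord_space n" "x \<noteq> 0"
    and GP: "\<And>S T. (S, T) \<in> restricted_GP_indices n \<Longrightarrow> GP_poly S T x = 0"
  shows "antisymmetric_matroid n {B \<in> transversals n \<union> almost_transversals n. x B \<noteq> 0}"
proof -
  define bs where "bs = {B \<in> transversals n \<union> almost_transversals n. x B \<noteq> 0}"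
  have bs: "B \<in> bs \<longleftrightarrow> x B \<noteq> 0" for B
    using x(1) unfolding bs_def coord_space_alt by blast
  have "antisymmetric_matroid n bs"
  proof
    show "bs \<subseteq> transversals n \<union> almost_transversals n" unfolding bs_def by blast
    show "bs \<noteq> {}" using x(2) bs by (auto simp: fun_eq_iff)
    show "(T \<union> p) - q \<in> bs \<longleftrightarrow> (T \<union> q) - p \<in> bs"
      if T: "T \<in> transversals n" and pq: "p \<in> skew_pairs n" "q \<in> skew_pairs n" "p \<noteq> q" for T p q
    proof -
      from T obtain X where X: "T = choice_set {1..n} X" by (auto simp: transversals_eq)
      from pq obtain i j where ij: "i \<in> {1..n}" "j \<in> {1..n}" "p = skew_pair i" "q = skew_pair j"
        unfolding skew_pairs_def by blast
      from ij pq have ne: "i \<noteq> j" by auto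
      let ?A = "choice_set ({1..n} - {i, j}) (X \<inter> ({1..n} - {i, j}))"
      have "linked n ?A i j" using ij ne unfolding linked_iff by blast
      then have "(-1) ^ i * x (?A \<union> skew_pair i) = (-1) ^ j * x (?A \<union> skew_pair j)"
        using x(1) unfolding coord_space_alt by blast
      moreover have "(T \<union> p) - q = ?A \<union> skew_pair i" "(T \<union> q) - p = ?A \<union> skew_pair j"
        using ij(1,2) ne unfolding ij(3,4) X by (auto simp: skew_pair_eq mem_choice_set)
      moreover have "x (?A \<union> skew_pair i) = 0 \<longleftrightarrow> x (?A \<union> skew_pair j) = 0"
        using calculation(1) by (auto simp: minus_one_power_iff split: if_splits)
      ultimately show ?thesis unfolding bs by simp
    qed
    show "\<exists>f \<in> B' - B. (B - {e}) \<union> {f} \<in> bs \<and> (B' \<union> {e}) - {f} \<in> bs"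
      if B: "B \<in> bs" "B' \<in> bs" and e: "e \<in> B - B'" and free: "skew_pairs_in n (B - {e}) = {}"
        and one: "card (skew_pairs_in n (B' \<union> {e})) = 1" for B B' e
    proof (rule ccontr)
      assume no: "\<not> ?thesis"
      have g: "B \<subseteq> ground n" "card B = n" "B' \<subseteq> ground n" "card B' = n"
        using B by (auto simp: bs_def transversals_def almost_transversals_def)
      then have fin: "finite B" "finite B'" using finite_ground finite_subset by blast+
      \<comment> \<open>The term at \<open>e\<close> of this relation is the product of the
        coordinates of \<open>B'\<close> and \<open>B\<close> up to sign, hence nonzero. Without an
        exchange element \<open>f\<close> every other term vanishes, which contradicts the
        relation.\<close>
      have "(B' \<union> {e}, B - {e}) \<in> restricted_GP_indices n"
        using g fin e free one card_Suc_Diff1[OF fin(1), of e] by (auto simp: restricted_GP_indices_def)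
      then have "0 = GP_poly (B' \<union> {e}) (B - {e}) x" using GP by simp
      also have "\<dots> = (\<Sum>f\<in>{e}. (-1) ^ (sigma (B' \<union> {e}) f + sigma (B - {e}) f) *
          x (B' \<union> {e} - {f}) * x (B - {e} \<union> {f}))"
        unfolding GP_poly_def
      proof (rule sum.mono_neutral_right)
        show "\<forall>f\<in>(B' \<union> {e}) - (B - {e}) - {e}. (-1) ^ (sigma (B' \<union> {e}) f + sigma (B - {e}) f) *
          x (B' \<union> {e} - {f}) * x (B - {e} \<union> {f}) = 0"
          using no unfolding bs by auto
      qed (use fin in auto)
      also have "B' \<union> {e} - {e} = B'" "B - {e} \<union> {e} = B" using e by auto
      then have "(\<Sum>f\<in>{e}. (-1) ^ (sigma (B' \<union> {e}) f + sigma (B - {e}) f) *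
          x (B' \<union> {e} - {f}) * x (B - {e} \<union> {f})) \<noteq> 0" using B by (simp add: bs)
      finally show False by simp
    qed
  qed
  then show ?thesis unfolding bs_def .
qed

theorem theorem1p3:
  fixes n :: nat and P :: "(elt set \<Rightarrow> 'k::field) set"
  assumes "n \<ge> 1" and "P \<in> projective_space n"
  shows "(\<forall>(S, T) \<in> restricted_GP_indices n. satisfies_GP P S T) \<longleftrightarrow>
    (\<forall>(S, T) \<in> restricted_GP_indices n. card (S - T) \<le> 4 \<longrightarrow> satisfies_GP P S T) \<and>
    antisymmetric_matroid n (point_support n P)"
proof -
  obtain x where x: "x \<in> coord_space n" "x \<noteq> 0" "P = proportional `` {x}"
    using assms(2) unfolding projective_space_def by (auto elim!: quotientE)
  have "x = scale_fun 1 x" by (simp add: scale_fun_def)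
  then have "x \<in> P" unfolding x(3) proportional_def by (auto intro!: exI[of _ 1])
  \<comment> \<open>Both sides of the equivalence now concern the single representative
    \<open>x\<close>.\<close>
  note repr = satisfies_GP_repr[OF assms(2) this] point_support_repr[OF assms(2) this]
  show ?thesis (is "?all \<longleftrightarrow> ?loc \<and> ?mat")
  proof
    assume ?all
    moreover from this have ?mat
      unfolding repr by (intro antisymmetric_matroid_support[OF x(1,2)]) auto
    ultimately show "?loc \<and> ?mat" by auto
  next
    assume lm: "?loc \<and> ?mat"
    then interpret antisymmetric_matroid n "point_support n P" by simp
    interpret local_GP n "point_support n P" x
    proof unfold_locales
      show "GP_poly S T x = 0" if "(S, T) \<in> restricted_GP_indices n" "card (S - T) \<le> 4" for S T
        using lm that repr(1) by blast
    qed (fact x(1) repr(2))+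
    show ?all using all_GP repr(1) by blast
  qed
qed

end
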